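(* Regard two permutations as equivalent if they are torically equivalent, and let $\mathbf p$ be the bivincular pattern $(213,\varnothing,\{1,3\})$. For every $n\ge1$, the set $\widetilde{\mathfrak A}_n(\mathbf p)$ consists of the natural permutations $\nu_{k,n}$ ($1\le k\le n$, $\gcd(k,n+1)=1$) in $\mathfrak S_n$. In particular $|\widetilde{\mathfrak A}_n(\mathbf p)|=\phi(n+1)$, where $\phi$ is Euler's totient function, and the map $\nu_{k,n}\mapsto k$, $\widetilde{\mathfrak A}_n(\mathbf p)\to U_{n+1}$, is a homomorphism of groups, where $\widetilde{\mathfrak A}_n(\mathbf p)$ carries composition of permutations and $U_{n+1}$ is the group of units in $\mathbb Z/(n+1)\mathbb Z$.
   Context: For $\pi\in\mathfrak S_n$ (one-line notation $\pi_1\cdots\pi_n$) and an integer $m$, the permutation $\pi\oplus m\in\mathfrak S_n$ is defined as follows: form the circular word $0\,\pi_1\pi_2\cdots\pi_n$ on $\{0,\dots,n\}$, add $m$ modulo $n+1$ to every letter, and read the resulting circular word starting just after the letter $0$. The toric class of $\pi$ is $\{\pi\oplus m: m=0,1,\dots,n\}$, and two permutations are torically equivalent if they are in the same toric class. An occurrence of the pattern $(213,\varnothing,\{1,3\})$ in $\pi\in\mathfrak S_n$ is a subsequence $\pi_{a}\pi_{b}\pi_{c}$ with $a<b<c$, in the same relative order as $213$, such that $\pi_a=\pi_b+1$ and $\pi_c=n$. A permutation avoids the pattern if it has no occurrence of it. $\widetilde{\mathfrak A}_n(\mathbf p)$ is the set of $\pi\in\mathfrak S_n$ such that $\pi$ and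 every permutation torically equivalent to $\pi$ avoids $\mathbf p$. Natural permutations: for $1\le k\le n$ coprime to $n+1$, build a circular permutation of $\{0,1,\dots,n\}$ on $n+1$ circular positions by placing $0$ anywhere, and then placing each letter $m+1$ exactly $k$ steps after the letter $m$, for $m=0,\dots,n-1$. Then $\nu_{k,n}\in\mathfrak S_n$ is the permutation obtained by reading this circular permutation starting just after $0$; equivalently the letter $m$ is at position $mk \bmod (n+1)$. *)

theory Defs
  imports "HOL-Algebra.Sym_Groups" "HOL-Number_Theory.Residues"
begin

text \<open>
  A permutation in \<open>S\<^sub>n\<close> is a function \<open>\<pi> :: nat \<Rightarrow> nat\<close> with
  \<open>\<pi> permutes {1..n}\<close>; its one-line notation is \<open>\<pi> 1 \<dots> \<pi> n\<close>.
\<close>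

text \<open>
  The circular word \<open>0 \<pi>\<^sub>1 \<dots> \<pi>\<^sub>n\<close>, with \<open>m\<close> added modulo \<open>n + 1\<close> to every letter.
  Positions are read modulo \<open>n + 1\<close>, the additional letter 0 being at position 0.
\<close>

definition shifted_word :: "nat \<Rightarrow> (nat \<Rightarrow> nat) \<Rightarrow> int \<Rightarrow> nat \<Rightarrow> nat" where
  "shifted_word n \<pi> m i =
     (let j = i mod (n + 1); letter = (if j = 0 then 0 else \<pi> j)
      in nat ((int letter + m) mod (int n + 1)))"

definition toric_add :: "nat \<Rightarrow> (nat \<Rightarrow> nat) \<Rightarrow> int \<Rightarrow> nat \<Rightarrow> nat" where
  "toric_add n \<pi> m =
     (let z = (THE z. z \<le> n \<and> shifted_word n \<pi> m z = 0)
      in (\<lambda>i. if i \<in> {1..n} then shifted_word n \<pi> m (z + i) else i))"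

definition toric_class :: "nat \<Rightarrow> (nat \<Rightarrow> nat) \<Rightarrow> (nat \<Rightarrow> nat) set" where
  "toric_class n \<pi> = {toric_add n \<pi> m | m. m \<in> {0..int n}}"

definition torically_equivalent :: "nat \<Rightarrow> (nat \<Rightarrow> nat) \<Rightarrow> (nat \<Rightarrow> nat) \<Rightarrow> bool" where
  "torically_equivalent n \<pi> \<sigma> \<longleftrightarrow>
     (\<exists>\<rho>. \<rho> permutes {1..n} \<and> \<pi> \<in> toric_class n \<rho> \<and> \<sigma> \<in> toric_class n \<rho>)"

text \<open>
  Occurrences, at positions \<open>a < b < c\<close>, of the bivincular pattern \<open>(213, \<emptyset>, {1, 3})\<close>:
  there is no adjacency requirement on positions, the element 1 of the last component
  requires the two smaller letters to be consecutive, and the element 3 requires the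
  largest letter to be \<open>n\<close>.
\<close>

definition occurrence_213 :: "nat \<Rightarrow> (nat \<Rightarrow> nat) \<Rightarrow> nat \<Rightarrow> nat \<Rightarrow> nat \<Rightarrow> bool" where
  "occurrence_213 n \<pi> a b c \<longleftrightarrow>
     a \<in> {1..n} \<and> b \<in> {1..n} \<and> c \<in> {1..n} \<and> a < b \<and> b < c \<and>
     \<pi> b < \<pi> a \<and> \<pi> a < \<pi> c \<and>
     \<pi> a = \<pi> b + 1 \<and> \<pi> c = n"

definition avoids_213 :: "nat \<Rightarrow> (nat \<Rightarrow> nat) \<Rightarrow> bool" where
  "avoids_213 n \<pi> \<longleftrightarrow> \<not> (\<exists>a b c. occurrence_213 n \<pi> a b c)"

definition toric_avoiders :: "(nat \<Rightarrow> (nat \<Rightarrow> nat) \<Rightarrow> bool) \<Rightarrow> nat \<Rightarrow> (nat \<Rightarrow> nat) set" where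
  "toric_avoiders avoids n =
     {\<pi>. \<pi> permutes {1..n} \<and> avoids n \<pi> \<and>
         (\<forall>\<sigma>. \<sigma> permutes {1..n} \<and> torically_equivalent n \<pi> \<sigma> \<longrightarrow> avoids n \<sigma>)}"

text \<open>
  The natural permutation \<open>\<nu>\<^sub>k\<^sub>,\<^sub>n\<close>: placing 0 at position 0 and each letter \<open>m + 1\<close> exactly
  \<open>k\<close> steps after \<open>m\<close> on \<open>n + 1\<close> circular positions puts \<open>m\<close> at position \<open>m * k mod (n + 1)\<close>.
  It is a permutation only for \<open>k\<close> coprime to \<open>n + 1\<close>.
\<close>

definition natural_perm :: "nat \<Rightarrow> nat \<Rightarrow> nat \<Rightarrow> nat" where
  "natural_perm k n i =
     (if i \<in> {1..n} then (THE m. m \<le> n \<and> (m * k) mod (n + 1) = i) else i)"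

end

theory Submission
  imports Defs
begin

text \<open>
  On the circle of positions draw, for every letter \<open>x\<close>, the arc from \<open>x\<close> forward to \<open>x + 1\<close>
  (modulo \<open>n + 1\<close>). All toric translates avoid the pattern iff no such arc lies strictly inside
  another one. If the arc starting at position \<open>p + 1\<close> is not nested in the one starting at \<open>p\<close>,
  its length is at least that of the latter, as equal end points are excluded. So the arc lengths
  increase weakly all around the circle, hence are constant, equal to some \<open>k\<close>, and the
  permutation is \<open>\<nu>\<^sub>k\<^sub>,\<^sub>n\<close>. A natural permutation is the only element of its toric class.
\<close>

section \<open>The circular word of a permutation\<close>

text \<open>Positions are arbitrary naturals read modulo n + 1, so arcs may run past the end of the
  word. Position 0 carries the extra letter 0, because a permutation of \<open>{1..n}\<close> fixes
  0.\<close>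

definition letter :: "nat \<Rightarrow> (nat \<Rightarrow> nat) \<Rightarrow> nat \<Rightarrow> nat" where
  "letter n \<pi> i = \<pi> (i mod (n + 1))"

lemma permutes_0: "\<pi> permutes {1..n} \<Longrightarrow> \<pi> 0 = (0::nat)"
  by (simp add: permutes_not_in)

lemma permutes_atMost: "\<pi> permutes {1..n} \<Longrightarrow> \<pi> permutes {..n::nat}"
  by (rule permutes_subset) auto

lemma letter_le:
  assumes "\<pi> permutes {1..n}"
  shows "letter n \<pi> i \<le> n"
proof -
  have "i mod (n + 1) \<in> {..n}" by (simp add: less_Suc_eq_le[symmetric])
  then show ?thesis
    using permutes_in_image[OF permutes_atMost[OF assms]] unfolding letter_def by blast
qed

lemma letter_eq_iff:
  assumes "\<pi> permutes {1..n}"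
  shows "letter n \<pi> i = letter n \<pi> j \<longleftrightarrow> [i = j] (mod (n + 1))"
  using permutes_inj[OF assms] by (auto simp: letter_def cong_def inj_eq)

lemma letter_cong: "[i = j] (mod (n + 1)) \<Longrightarrow> letter n \<pi> i = letter n \<pi> j"
  by (simp add: letter_def cong_def)

lemma letter_surj:
  assumes "\<pi> permutes {1..n}" "x \<le> n"
  obtains i where "i \<le> n" "letter n \<pi> i = x"
proof -
  have "x \<in> \<pi> ` {..n}"
    using permutes_image[OF permutes_atMost[OF assms(1)]] assms(2) by auto
  then obtain i where "i \<le> n" "x = \<pi> i" by auto
  then show ?thesis using that[of i] by (simp add: letter_def)
qed

lemma letter_small: "i \<le> n \<Longrightarrow> letter n \<pi> i = \<pi> i"
  by (simp add: letter_def)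

text \<open>Letters lie between 0 and n, so congruence modulo n + 1 is equality for them. This lets
  shifted letters be compared by integer congruences.\<close>

lemma cong_letters_iff:
  assumes "\<pi> permutes {1..n}"
  shows "[int (letter n \<pi> i) = int (letter n \<pi> j)] (mod (int n + 1)) \<longleftrightarrow> [i = j] (mod (n + 1))"
proof -
  have "[int (letter n \<pi> i) = int (letter n \<pi> j)] (mod (int n + 1)) \<longleftrightarrow>
        letter n \<pi> i = letter n \<pi> j"
    using letter_le[OF assms, of i] letter_le[OF assms, of j] by (simp add: cong_def)
  then show ?thesis using letter_eq_iff[OF assms] by simp
qed

section \<open>Toric translates\<close>

lemma shifted_word_eq:
  assumes "\<pi> permutes {1..n}"
  shows "int (shifted_word n \<pi> m i) = (int (letter n \<pi> i) + m) mod (int n + 1)"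
  using permutes_0[OF assms] by (simp add: shifted_word_def letter_def Let_def)

lemma shifted_word_eq_iff:
  assumes "\<pi> permutes {1..n}"
  shows "shifted_word n \<pi> m i = shifted_word n \<pi> m j \<longleftrightarrow> [i = j] (mod (n + 1))"
proof -
  have "shifted_word n \<pi> m i = shifted_word n \<pi> m j \<longleftrightarrow>
        [int (letter n \<pi> i) + m = int (letter n \<pi> j) + m] (mod (int n + 1))"
    unfolding cong_def shifted_word_eq[OF assms, symmetric] by simp
  then show ?thesis by (simp add: cong_add_rcancel cong_letters_iff[OF assms])
qed

text \<open>Justifies the \<open>THE\<close> in \<open>toric_add\<close>: the shifted word vanishes
  where the original letter is -m modulo n + 1, and only there, because it is injective on positions
  modulo n + 1.\<close>

lemma toric_add_zero_position:
  assumes "\<pi> permutes {1..n}"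
  obtains z where "z \<le> n" "shifted_word n \<pi> m z = 0"
    "toric_add n \<pi> m = (\<lambda>i. if i \<in> {1..n} then shifted_word n \<pi> m (z + i) else i)"
proof -
  define x where "x = nat ((- m) mod (int n + 1))"
  have "(- m) mod (int n + 1) < int n + 1" by (rule pos_mod_bound) simp
  then have "x \<le> n" unfolding x_def by linarith
  then obtain z where z: "z \<le> n" "letter n \<pi> z = x" using letter_surj[OF assms] by blast
  have "int (shifted_word n \<pi> m z) = 0"
    unfolding shifted_word_eq[OF assms] z(2) x_def by (simp add: mod_simps)
  then have z0: "shifted_word n \<pi> m z = 0" by simp
  have "(THE z. z \<le> n \<and> shifted_word n \<pi> m z = 0) = z"
  proof (rule the_equality)
    fix y assume y: "y \<le> n \<and> shifted_word n \<pi> m y = 0"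
    then have "[y = z] (mod (n + 1))" using z0 shifted_word_eq_iff[OF assms] by metis
    then show "y = z" using y z(1) by (simp add: cong_def)
  qed (use z z0 in auto)
  then show ?thesis using that[OF z(1) z0] unfolding toric_add_def by simp
qed

lemma toric_add_permutes:
  assumes "\<pi> permutes {1..n}"
  shows "toric_add n \<pi> m permutes {1..n}"
proof -
  obtain z where z_le: "z \<le> n" and z: "shifted_word n \<pi> m z = 0"
    "toric_add n \<pi> m = (\<lambda>i. if i \<in> {1..n} then shifted_word n \<pi> m (z + i) else i)"
    by (rule toric_add_zero_position[OF assms])
  have inj: "inj_on (toric_add n \<pi> m) {1..n}"
  proof (rule inj_onI)
    fix i j assume ij: "i \<in> {1..n}" "j \<in> {1..n}" "toric_add n \<pi> m i = toric_add n \<pi> m j"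
    then have "[z + i = z + j] (mod (n + 1))" using z(2) shifted_word_eq_iff[OF assms] by simp
    then have "[i = j] (mod (n + 1))" by (simp add: cong_add_lcancel_nat)
    then show "i = j" using ij by (simp add: cong_def)
  qed
  have "toric_add n \<pi> m ` {1..n} \<subseteq> {1..n}"
  proof
    fix y assume "y \<in> toric_add n \<pi> m ` {1..n}"
    then obtain i where i: "i \<in> {1..n}" "y = shifted_word n \<pi> m (z + i)" using z(2) by auto
    have "int y < int n + 1"
      unfolding i(2) shifted_word_eq[OF assms] by (rule pos_mod_bound) simp
    moreover have "y \<noteq> 0"
    proof
      assume "y = 0"
      then have "shifted_word n \<pi> m (z + i) = shifted_word n \<pi> m (z + 0)" using i(2) z(1) by simp
      then have "[z + i = z + 0] (mod (n + 1))" using shifted_word_eq_iff[OF assms] by blast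
      then have "[i = 0] (mod (n + 1))" by (subst (asm) cong_add_lcancel_nat)
      then show False using i(1) by (simp add: cong_def)
    qed
    ultimately show "y \<in> {1..n}" by auto
  qed
  then have "toric_add n \<pi> m ` {1..n} = {1..n}" using inj by (simp add: endo_inj_surj)
  then show ?thesis
    using inj z(2) by (intro bij_imp_permutes) (auto simp: bij_betw_def)
qed

text \<open>The only description of \<open>toric_add\<close> needed for computing its values. It
  includes i = 0, where both sides are 0, so later congruences need no case split.\<close>

lemma toric_add_eq:
  assumes "\<pi> permutes {1..n}"
  shows "\<exists>z\<le>n. [int (letter n \<pi> z) = - m] (mod (int n + 1)) \<and>
    (\<forall>i\<le>n. int (toric_add n \<pi> m i) = (int (letter n \<pi> (z + i)) + m) mod (int n + 1))"
proof -
  obtain z where z: "z \<le> n" "shifted_word n \<pi> m z = 0"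
    "toric_add n \<pi> m = (\<lambda>i. if i \<in> {1..n} then shifted_word n \<pi> m (z + i) else i)"
    by (rule toric_add_zero_position[OF assms])
  have 0: "(int (letter n \<pi> z) + m) mod (int n + 1) = 0"
    using shifted_word_eq[OF assms, of m z] z(2) by simp
  then have "[int (letter n \<pi> z) = - m] (mod (int n + 1))"
    by (simp add: cong_iff_dvd_diff mod_eq_0_iff_dvd)
  moreover have "int (toric_add n \<pi> m i) = (int (letter n \<pi> (z + i)) + m) mod (int n + 1)"
    if "i \<le> n" for i
    using that 0 shifted_word_eq[OF assms, of m "z + i"] z(3) by (cases "i = 0") auto
  ultimately show ?thesis using z(1) by blast
qed

lemma toric_add_0:
  assumes "\<pi> permutes {1..n}"
  shows "toric_add n \<pi> 0 = \<pi>"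
proof
  fix i
  show "toric_add n \<pi> 0 i = \<pi> i"
  proof (cases "i \<le> n")
    case True
    obtain z where z: "z \<le> n" "[int (letter n \<pi> z) = - 0] (mod (int n + 1))"
      "\<And>i. i \<le> n \<Longrightarrow> int (toric_add n \<pi> 0 i) = (int (letter n \<pi> (z + i)) + 0) mod (int n + 1)"
      using toric_add_eq[OF assms, of 0] by blast
    have "[int (letter n \<pi> z) = int (letter n \<pi> 0)] (mod (int n + 1))"
      using z(2) permutes_0[OF assms] by (simp add: letter_def)
    then have "z = 0" using cong_letters_iff[OF assms] z(1) by (simp add: cong_def)
    then show ?thesis using z(3)[OF True] letter_le[OF assms, of i] True by (simp add: letter_small)
  next
    case False
    then show ?thesis
      using toric_add_permutes[OF assms, of 0] assms by (simp add: permutes_not_in)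
  qed
qed

section \<open>Lengths of the arcs between successive letters\<close>

text \<open>The length of the arc from position p forward to the letter that follows cyclically. The
  bound by n selects one representative modulo n + 1.\<close>

definition jump :: "nat \<Rightarrow> (nat \<Rightarrow> nat) \<Rightarrow> nat \<Rightarrow> nat" where
  "jump n \<pi> p = (THE e. e \<le> n \<and>
     [int (letter n \<pi> (p + e)) = int (letter n \<pi> p) + 1] (mod (int n + 1)))"

lemma jump_unique:
  assumes "\<pi> permutes {1..n}" "e \<le> n"
    "[int (letter n \<pi> (p + e)) = int (letter n \<pi> p) + 1] (mod (int n + 1))"
  shows "jump n \<pi> p = e"
  unfolding jump_def
proof (rule the_equality)
  fix d assume d: "d \<le> n \<and> [int (letter n \<pi> (p + d)) = int (letter n \<pi> p) + 1] (mod (int n + 1))"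
  then have "[int (letter n \<pi> (p + d)) = int (letter n \<pi> (p + e))] (mod (int n + 1))"
    using assms(3) cong_sym cong_trans by blast
  then have "[d = e] (mod (n + 1))"
    unfolding cong_letters_iff[OF assms(1)] by (simp add: cong_add_lcancel_nat)
  then show "d = e" using d assms(2) by (simp add: cong_def)
qed (use assms in auto)

lemma jump:
  assumes "\<pi> permutes {1..n}"
  shows "jump n \<pi> p \<le> n"
    "[int (letter n \<pi> (p + jump n \<pi> p)) = int (letter n \<pi> p) + 1] (mod (int n + 1))"
proof -
  have "(letter n \<pi> p + 1) mod (n + 1) \<le> n"
    by (simp add: less_Suc_eq_le[symmetric])
  then obtain q where q: "q \<le> n" "letter n \<pi> q = (letter n \<pi> p + 1) mod (n + 1)"
    using letter_surj[OF assms] by blast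
  \<comment> \<open>The distance from p forward to q; the summand \<open>(n + 1) * p\<close> keeps
    the natural subtraction from truncating.\<close>
  define e where "e = (q + (n + 1) * p - p) mod (n + 1)"
  have e: "e \<le> n" unfolding e_def by (simp add: less_Suc_eq_le[symmetric])
  have "[p + e = q] (mod (n + 1))"
  proof -
    have "p + (q + (n + 1) * p - p) = q + (n + 1) * p" by simp
    then show ?thesis unfolding e_def cong_def by (metis mod_add_right_eq mod_mult_self2)
  qed
  then have "letter n \<pi> (p + e) = letter n \<pi> q" by (rule letter_cong)
  then have "int (letter n \<pi> (p + e)) = (int (letter n \<pi> p) + 1) mod (int n + 1)"
    using q(2) by (simp add: of_nat_mod add.commute)
  then have c: "[int (letter n \<pi> (p + e)) = int (letter n \<pi> p) + 1] (mod (int n + 1))"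
    by (simp add: cong_def)
  have "jump n \<pi> p = e" by (rule jump_unique[OF assms e c])
  then show "jump n \<pi> p \<le> n"
    "[int (letter n \<pi> (p + jump n \<pi> p)) = int (letter n \<pi> p) + 1] (mod (int n + 1))"
    using e c by simp_all
qed

lemma jump_pos:
  assumes "\<pi> permutes {1..n}" "n \<ge> 1"
  shows "jump n \<pi> p \<ge> 1"
proof (rule ccontr)
  assume "\<not> jump n \<pi> p \<ge> 1"
  then have "jump n \<pi> p = 0" by simp
  then have "[int (letter n \<pi> p) + 0 = int (letter n \<pi> p) + 1] (mod (int n + 1))"
    using jump(2)[OF assms(1), of p] by simp
  then have "[0 = 1::int] (mod (int n + 1))" by (subst (asm) cong_add_lcancel)
  then show False using assms(2) by (simp add: cong_def)
qed

text \<open>If the jump decreased, the arc from \<open>p + 1\<close> to its successor letter would be nested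
  strictly inside the arc from \<open>p\<close>; reading the word from the end of the inner arc, the four
  endpoints are the letters \<open>0\<close>, \<open>x + 1\<close>, \<open>x\<close>, \<open>n\<close> of a shift, in this order.\<close>

lemma jump_mono_step:
  assumes perm: "\<pi> permutes {1..n}" and n: "n \<ge> 1"
    and av: "\<And>m. m \<in> {0..int n} \<Longrightarrow> avoids_213 n (toric_add n \<pi> m)"
  shows "jump n \<pi> p \<le> jump n \<pi> (Suc p)"
proof (rule ccontr)
  define e where "e = jump n \<pi> p"
  define e' where "e' = jump n \<pi> (p + 1)"
  assume "\<not> jump n \<pi> p \<le> jump n \<pi> (Suc p)"
  then have less: "e' < e" unfolding e_def e'_def by simp
  have e: "e \<le> n" "[int (letter n \<pi> (p + e)) = int (letter n \<pi> p) + 1] (mod (int n + 1))"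
    unfolding e_def using jump[OF perm] by auto
  have e': "1 \<le> e'" "[int (letter n \<pi> (p + 1 + e')) = int (letter n \<pi> (p + 1)) + 1] (mod (int n + 1))"
    unfolding e'_def by (fact jump_pos[OF perm n], fact jump(2)[OF perm])
  \<comment> \<open>Otherwise both arcs end at the same position, which forces equal letters at p
    and p + 1.\<close>
  have "e \<noteq> e' + 1"
  proof
    assume "e = e' + 1"
    then have "[int (letter n \<pi> p) + 1 = int (letter n \<pi> (p + 1)) + 1] (mod (int n + 1))"
      using e(2) e'(2) by (simp add: cong_def)
    then have "[int (letter n \<pi> p) = int (letter n \<pi> (p + 1))] (mod (int n + 1))"
      by (subst (asm) cong_add_rcancel)
    then have "[p + 0 = p + 1] (mod (n + 1))" using cong_letters_iff[OF perm] by simp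
    then have "[0 = 1] (mod (n + 1))" by (subst (asm) cong_add_lcancel_nat)
    then show False using n by (simp add: cong_def)
  qed
  with less have less: "e' + 1 < e" by simp
  \<comment> \<open>This shift turns the letter at the end of the inner arc into 0, so the translate
    is read from there.\<close>
  define m where "m = (- int (letter n \<pi> (p + 1 + e'))) mod (int n + 1)"
  have m: "m \<in> {0..int n}"
    unfolding m_def using pos_mod_bound[of "int n + 1" "- int (letter n \<pi> (p + 1 + e'))"] by simp
  define \<sigma> where "\<sigma> = toric_add n \<pi> m"
  have \<sigma>: "\<sigma> permutes {1..n}" unfolding \<sigma>_def by (rule toric_add_permutes[OF perm])
  obtain z where z_le: "z \<le> n" and z: "[int (letter n \<pi> z) = - m] (mod (int n + 1))"
    "\<And>i. i \<le> n \<Longrightarrow> int (\<sigma> i) = (int (letter n \<pi> (z + i)) + m) mod (int n + 1)"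
    unfolding \<sigma>_def using toric_add_eq[OF perm, of m] by blast
  have "[- m = int (letter n \<pi> (p + 1 + e'))] (mod (int n + 1))"
    unfolding m_def by (simp add: cong_def mod_simps)
  with z(1) have "[z = p + 1 + e'] (mod (n + 1))"
    using cong_letters_iff[OF perm] cong_trans by blast
  then have zl: "letter n \<pi> (z + i) = letter n \<pi> (p + 1 + e' + i)" for i
    by (intro letter_cong) (simp only: cong_add_rcancel_nat)
  have per: "letter n \<pi> (i + (n + 1)) = letter n \<pi> i" for i
    unfolding letter_def mod_add_self2 ..
  \<comment> \<open>Measured from the end p + 1 + e' of the inner arc, these are the distances to p
    + e, to p and to p + 1, the last two after going once around the circle.\<close>
  define a where "a = e - 1 - e'"
  define b where "b = n - e'"
  define c where "c = n + 1 - e'"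
  have abc: "1 \<le> a" "a < b" "b < c" "c \<le> n"
    unfolding a_def b_def c_def using less e(1) e'(1) by auto
  have sa: "int (\<sigma> a) = (int (letter n \<pi> (p + e)) + m) mod (int n + 1)"
    using z(2)[of a] zl[of a] abc less unfolding a_def by (simp add: algebra_simps)
  have "p + 1 + e' + b = p + (n + 1)" unfolding b_def using less e(1) by simp
  then have sb: "int (\<sigma> b) = (int (letter n \<pi> p) + m) mod (int n + 1)"
    using z(2)[of b] zl[of b] abc per[of p] by (simp only:)
  have "p + 1 + e' + c = p + 1 + (n + 1)" unfolding c_def using less e(1) by simp
  then have sc: "int (\<sigma> c) = (int (letter n \<pi> (p + 1)) + m) mod (int n + 1)"
    using z(2)[of c] zl[of c] abc per[of "p + 1"] by (simp only:)
  \<comment> \<open>The inner arc raises its letter by one and ends at 0, so it starts at -1, that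
    is, at n.\<close>
  have "[int (\<sigma> c) = int (letter n \<pi> (p + 1)) - int (letter n \<pi> (p + 1 + e'))] (mod (int n + 1))"
    unfolding sc m_def cong_def by (simp add: mod_simps)
  moreover have "[int (letter n \<pi> (p + 1)) - int (letter n \<pi> (p + 1 + e')) = - 1] (mod (int n + 1))"
  proof -
    have "int (letter n \<pi> (p + 1)) - int (letter n \<pi> (p + 1 + e')) - - 1
        = - (int (letter n \<pi> (p + 1 + e')) - (int (letter n \<pi> (p + 1)) + 1))" by simp
    then show ?thesis using e'(2) by (simp only: cong_iff_dvd_diff dvd_minus_iff)
  qed
  moreover have "[- 1 = int n] (mod (int n + 1))"
    by (simp add: cong_iff_dvd_diff) (metis dvd_minus_iff dvd_refl minus_add_distrib uminus_add_conv_diff add.commute)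
  ultimately have "[int (\<sigma> c) = int n] (mod (int n + 1))"
    using cong_trans by blast
  then have c_n: "\<sigma> c = n"
    using letter_le[OF \<sigma>, of c] abc by (simp add: cong_def letter_small)
  have ne: "\<sigma> a \<noteq> n" "\<sigma> b \<noteq> n"
    using inj_eq[OF permutes_inj[OF \<sigma>], of _ c] c_n abc by auto
  have le: "\<sigma> a \<le> n" "\<sigma> b \<le> n"
    using letter_le[OF \<sigma>, of a] letter_le[OF \<sigma>, of b] abc by (auto simp: letter_small)
  have "[int (\<sigma> a) = int (letter n \<pi> p) + 1 + m] (mod (int n + 1))"
    unfolding sa using e(2) by (simp add: cong_add_rcancel)
  moreover have "[int (\<sigma> b) + 1 = int (letter n \<pi> p) + 1 + m] (mod (int n + 1))"
    unfolding sb by (simp add: cong_def mod_simps algebra_simps)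
  ultimately have "[int (\<sigma> a) = int (\<sigma> b) + 1] (mod (int n + 1))"
    by (simp add: cong_def)
  \<comment> \<open>The value n is already taken at c, so \<open>\<sigma> b + 1\<close> does not
    wrap around to 0.\<close>
  then have "\<sigma> a = \<sigma> b + 1" using ne le by (simp add: cong_def)
  then have "occurrence_213 n \<sigma> a b c"
    unfolding occurrence_213_def using abc ne le c_n by auto
  then show False using av[OF m] unfolding avoids_213_def \<sigma>_def by blast
qed

section \<open>Natural permutations\<close>

text \<open>Every identification with a natural permutation goes through this criterion. A solution
  m of the \<open>THE\<close> is itself the letter at some position j, and the congruence at j
  forces j = i.\<close>

lemma natural_perm_unique:
  assumes perm: "\<pi> permutes {1..n}"
    and k: "\<And>i. i \<le> n \<Longrightarrow> [\<pi> i * k = i] (mod (n + 1))"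
  shows "\<pi> = natural_perm k n"
proof
  fix i
  show "\<pi> i = natural_perm k n i"
  proof (cases "i \<in> {1..n}")
    case False
    then show ?thesis using perm unfolding natural_perm_def by (auto simp: permutes_not_in)
  next
    case True
    have "(THE m. m \<le> n \<and> (m * k) mod (n + 1) = i) = \<pi> i"
    proof (rule the_equality)
      show "\<pi> i \<le> n \<and> (\<pi> i * k) mod (n + 1) = i"
        using k[of i] True letter_le[OF perm, of i] by (simp add: cong_def letter_small)
    next
      fix m assume m: "m \<le> n \<and> (m * k) mod (n + 1) = i"
      then obtain j where j: "j \<le> n" "letter n \<pi> j = m" using letter_surj[OF perm] by blast
      then have "\<pi> j = m" by (simp add: letter_small)
      then show "m = \<pi> i" using m k[OF j(1)] j(1) by (auto simp: cong_def)
    qed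
    then show ?thesis using True unfolding natural_perm_def by simp
  qed
qed

text \<open>Since k is a unit modulo n + 1, multiplication by k permutes the residues and fixes 0.
  This map q sends letters to positions, and \<open>natural_perm k n\<close> is its inverse.\<close>

lemma natural_perm:
  assumes "coprime k (n + 1)"
  shows "natural_perm k n permutes {1..n}"
    "i \<le> n \<Longrightarrow> [natural_perm k n i * k = i] (mod (n + 1))"
proof -
  define q where "q m = (if m \<in> {1..n} then m * k mod (n + 1) else m)" for m
  have q0: "q m = m * k mod (n + 1)" if "m \<le> n" for m
    using that unfolding q_def by (cases "m = 0") auto
  have inj: "inj_on q {..n}"
  proof (rule inj_onI)
    fix x y assume xy: "x \<in> {..n}" "y \<in> {..n}" "q x = q y"
    then have "[x * k = y * k] (mod (n + 1))" using q0 by (simp add: cong_def)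
    then have "[x = y] (mod (n + 1))" using assms cong_mult_rcancel_nat by blast
    then show "x = y" using xy by (simp add: cong_def)
  qed
  have "q ` {1..n} \<subseteq> {1..n}"
  proof
    fix y assume "y \<in> q ` {1..n}"
    then obtain x where x: "x \<in> {1..n}" "y = q x" by blast
    then have "q x \<noteq> q 0" using inj by (force simp: inj_on_def)
    moreover have "q x < n + 1" using x q0 by simp
    ultimately show "y \<in> {1..n}" using x q0[of 0] by auto
  qed
  moreover have inj': "inj_on q {1..n}" using inj by (rule inj_on_subset) auto
  ultimately have "q ` {1..n} = {1..n}" by (simp add: endo_inj_surj)
  then have q: "q permutes {1..n}"
    using inj' by (intro bij_imp_permutes) (auto simp: bij_betw_def q_def)
  have iq: "inv' q permutes {1..n}" by (rule permutes_inv[OF q])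
  have c: "[inv' q i * k = i] (mod (n + 1))" if "i \<le> n" for i
  proof -
    have "inv' q i \<le> n" using letter_le[OF iq, of i] that by (simp add: letter_small)
    then have "i = inv' q i * k mod (n + 1)"
      using q0[of "inv' q i"] permutes_inverses(1)[OF q] by simp
    then show ?thesis using that by (simp add: cong_def)
  qed
  have "inv' q = natural_perm k n" by (rule natural_perm_unique[OF iq c])
  then show "natural_perm k n permutes {1..n}"
    "i \<le> n \<Longrightarrow> [natural_perm k n i * k = i] (mod (n + 1))"
    using iq c by auto
qed

text \<open>The letter 1 stands at position k, so k can be recovered from the permutation.\<close>

lemma natural_perm_self:
  assumes "coprime k (n + 1)" "k \<le> n" "1 \<le> n"
  shows "natural_perm k n k = 1"
proof -
  let ?x = "natural_perm k n k"
  have "[?x * k = 1 * k] (mod (n + 1))" using natural_perm(2)[OF assms(1,2)] by simp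
  then have "[?x = 1] (mod (n + 1))" using assms(1) cong_mult_rcancel_nat by blast
  moreover have "?x \<le> n"
    using letter_le[OF natural_perm(1)[OF assms(1)], of k] assms(2) by (simp add: letter_small)
  ultimately show ?thesis using assms(3) by (simp add: cong_def)
qed

lemma natural_perm_mod: "natural_perm (k mod (n + 1)) n = natural_perm k n"
  unfolding natural_perm_def by (simp only: mod_mult_right_eq)

text \<open>On positions, \<open>natural_perm k n\<close> is division by k modulo n + 1, and
  dividing by l and then by k is dividing by their product.\<close>

lemma natural_perm_comp:
  assumes "coprime k (n + 1)" "coprime l (n + 1)"
  shows "natural_perm k n \<circ> natural_perm l n = natural_perm (k * l mod (n + 1)) n"
  unfolding natural_perm_mod
proof (rule natural_perm_unique)
  note k = natural_perm[OF assms(1)] and l = natural_perm[OF assms(2)]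
  show "natural_perm k n \<circ> natural_perm l n permutes {1..n}"
    by (rule permutes_compose[OF l(1) k(1)])
  fix i assume i: "i \<le> n"
  have "natural_perm l n i \<le> n" using letter_le[OF l(1), of i] i by (simp add: letter_small)
  then have "[natural_perm k n (natural_perm l n i) * k * l = natural_perm l n i * l] (mod (n + 1))"
    using k(2) by (intro cong_mult) auto
  then show "[(natural_perm k n \<circ> natural_perm l n) i * (k * l) = i] (mod (n + 1))"
    using l(2)[OF i] by (simp add: mult.assoc) (meson cong_trans)
qed

lemma natural_perm_one: "natural_perm 1 n = id"
  by (rule natural_perm_unique[symmetric]) (auto simp: permutes_id)

lemma coprime_mod_range:
  assumes "coprime k (n + 1)" "n \<ge> (1::nat)"
  shows "1 \<le> k mod (n + 1)" "k mod (n + 1) \<le> n" "coprime (k mod (n + 1)) (n + 1)"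
proof -
  show c: "coprime (k mod (n + 1)) (n + 1)" using assms(1) by (simp add: coprime_mod_left_iff)
  show "k mod (n + 1) \<le> n" by (simp add: less_Suc_eq_le[symmetric])
  have "k mod (n + 1) \<noteq> 0"
  proof
    assume "k mod (n + 1) = 0"
    then have "coprime 0 (n + 1)" using c by metis
    then show False using assms(2) by simp
  qed
  then show "1 \<le> k mod (n + 1)" by simp
qed

section \<open>Avoidance and toric invariance of natural permutations\<close>

text \<open>In an occurrence, a is b + k modulo n + 1, and a < b forces a wrap-around, so b is at
  least n + 1 - k. But n + 1 - k is the position c of the letter n, contradicting b < c.\<close>

lemma natural_perm_avoids:
  assumes "coprime k (n + 1)" "1 \<le> k" "k \<le> n"
  shows "avoids_213 n (natural_perm k n)"
  unfolding avoids_213_def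
proof
  let ?\<nu> = "natural_perm k n"
  assume "\<exists>a b c. occurrence_213 n ?\<nu> a b c"
  then obtain a b c where *: "a \<in> {1..n}" "b \<in> {1..n}" "c \<in> {1..n}" "a < b" "b < c"
    "?\<nu> a = ?\<nu> b + 1" "?\<nu> c = n"
    unfolding occurrence_213_def by auto
  note nk = natural_perm(2)[OF assms(1)]
  have "[a = (?\<nu> b + 1) * k] (mod (n + 1))" using nk[of a] * by (simp add: cong_sym)
  moreover have "[?\<nu> b * k + k = b + k] (mod (n + 1))"
    using nk[of b] * by (simp add: cong_add_rcancel_nat)
  ultimately have "[a = b + k] (mod (n + 1))" by (simp add: cong_def add.commute)
  then have a: "a mod (n + 1) = (b + k) mod (n + 1)" by (simp add: cong_def)
  have "b + k \<ge> n + 1"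
  proof (rule ccontr)
    assume "\<not> b + k \<ge> n + 1"
    then have "a = b + k" using a * by simp
    then show False using * by simp
  qed
  moreover have "c + k = n + 1"
  proof -
    have "[n * k + k = c + k] (mod (n + 1))" using nk[of c] * by (simp add: cong_add_rcancel_nat)
    moreover have "n * k + k = (n + 1) * k" by simp
    ultimately have "n + 1 dvd c + k"
      by (metis cong_dvd_iff dvd_triv_left)
    then obtain t where t: "c + k = (n + 1) * t" by (auto elim: dvdE)
    \<comment> \<open>The only multiple of n + 1 strictly between 0 and twice n + 1 is n + 1
      itself.\<close>
    have "c + k < (n + 1) * 2" "0 < c + k" using * assms by auto
    then have "t < 2" "0 < t" unfolding t by (auto simp del: mult_Suc)
    then have "t = 1" by simp
    then show ?thesis using t by simp
  qed
  ultimately show False using * by simp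
qed

text \<open>With letters as quotients by k, the new start z satisfies z / k = -m, so the letter (z +
  i) / k + m at offset i is i / k again.\<close>

lemma toric_add_natural:
  assumes "coprime k (n + 1)"
  shows "toric_add n (natural_perm k n) m = natural_perm k n"
proof (rule natural_perm_unique)
  let ?\<nu> = "natural_perm k n"
  note perm = natural_perm(1)[OF assms]
  show "toric_add n ?\<nu> m permutes {1..n}" by (rule toric_add_permutes[OF perm])
  obtain z where z: "z \<le> n" "[int (letter n ?\<nu> z) = - m] (mod (int n + 1))"
    "\<And>i. i \<le> n \<Longrightarrow> int (toric_add n ?\<nu> m i) = (int (letter n ?\<nu> (z + i)) + m) mod (int n + 1)"
    using toric_add_eq[OF perm, of m] by blast
  have l: "[int (letter n ?\<nu> i) * int k = int i] (mod (int n + 1))" for i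
  proof -
    have "i mod (n + 1) \<le> n" by (simp add: less_Suc_eq_le[symmetric])
    then have "[letter n ?\<nu> i * k = i mod (n + 1)] (mod (n + 1))"
      using natural_perm(2)[OF assms] unfolding letter_def by blast
    then have "[letter n ?\<nu> i * k = i] (mod (n + 1))" by (simp add: cong_def)
    then have "[int (letter n ?\<nu> i * k) = int i] (mod int (n + 1))"
      by (simp only: cong_int_iff)
    then show ?thesis by (simp add: add.commute)
  qed
  fix i assume i: "i \<le> n"
  have "[int (toric_add n ?\<nu> m i) * int k = (int (letter n ?\<nu> (z + i)) + m) * int k] (mod (int n + 1))"
    unfolding z(3)[OF i] by (simp add: cong_def mod_simps)
  also have "(int (letter n ?\<nu> (z + i)) + m) * int k
      = int (letter n ?\<nu> (z + i)) * int k - (- m) * int k" by (simp add: algebra_simps)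
  also have "[int (letter n ?\<nu> (z + i)) * int k - (- m) * int k =
      int (z + i) - int (letter n ?\<nu> z) * int k] (mod (int n + 1))"
    by (rule cong_diff[OF l cong_scalar_right[OF cong_sym[OF z(2)]]])
  also have "[int (z + i) - int (letter n ?\<nu> z) * int k = int (z + i) - int z] (mod (int n + 1))"
    by (rule cong_diff[OF cong_refl l])
  finally have "[int (toric_add n ?\<nu> m i * k) = int i] (mod int (n + 1))"
    by (simp add: add.commute)
  then show "[toric_add n ?\<nu> m i * k = i] (mod (n + 1))"
    by (simp only: cong_int_iff)
qed

text \<open>Toric equivalence is defined through a common source \<open>\<rho>\<close>, so
  naturality must be carried back from a translate to its source. Undoing the shift gives
  \<open>\<rho> i * k\<close> as i plus a constant, and the constant vanishes because
  \<open>\<rho>\<close> fixes 0.\<close>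

lemma toric_add_eq_naturalD:
  assumes perm: "\<rho> permutes {1..n}" and k: "coprime k (n + 1)"
    and eq: "toric_add n \<rho> m = natural_perm k n"
  shows "\<rho> = natural_perm k n"
proof (rule natural_perm_unique[OF perm])
  let ?\<nu> = "natural_perm k n"
  obtain z where z: "z \<le> n" "[int (letter n \<rho> z) = - m] (mod (int n + 1))"
    "\<And>i. i \<le> n \<Longrightarrow> int (?\<nu> i) = (int (letter n \<rho> (z + i)) + m) mod (int n + 1)"
    using toric_add_eq[OF perm, of m] unfolding eq by blast
  have step: "[int (\<rho> i) * int k = int i - int z - m * int k] (mod (int n + 1))" if i: "i \<le> n" for i
  proof -
    \<comment> \<open>The offset from z forward to i; adding n + 1 avoids truncated
      subtraction.\<close>
    define j where "j = (i + (n + 1) - z) mod (n + 1)"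
    have j: "j \<le> n" unfolding j_def by (simp add: less_Suc_eq_le[symmetric])
    have zj: "[z + j = i] (mod (n + 1))"
      proof -
      have "z + (i + (n + 1) - z) = i + (n + 1)" using z(1) by simp
      then show ?thesis unfolding j_def cong_def by (metis mod_add_right_eq mod_add_self2)
    qed
    then have "letter n \<rho> (z + j) = \<rho> i"
      using letter_cong letter_small[OF i] by metis
    then have "[int (?\<nu> j) = int (\<rho> i) + m] (mod (int n + 1))"
      using z(3)[OF j] by (simp add: cong_def)
    then have "[int (\<rho> i) = int (?\<nu> j) - m] (mod (int n + 1))"
      by (simp add: cong_iff_dvd_diff dvd_diff_commute algebra_simps)
    then have "[int (\<rho> i) * int k = (int (?\<nu> j) - m) * int k] (mod (int n + 1))"
      by (rule cong_scalar_right)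
    also have "(int (?\<nu> j) - m) * int k = int (?\<nu> j * k) - m * int k" by (simp add: algebra_simps)
    also have "[int (?\<nu> j * k) - m * int k = int j - m * int k] (mod (int n + 1))"
      using natural_perm(2)[OF k j, folded cong_int_iff]
      by (intro cong_diff) (auto simp: add.commute)
    also have "[int j - m * int k = (int i - int z) - m * int k] (mod (int n + 1))"
    proof (rule cong_diff)
      have "[int (z + j) = int i] (mod int (n + 1))" using zj by (simp only: cong_int_iff)
      then show "[int j = int i - int z] (mod (int n + 1))"
        by (simp add: cong_iff_dvd_diff algebra_simps)
    qed simp
    finally show ?thesis .
  qed
  have 0: "[0 = - int z - m * int k] (mod (int n + 1))" using step[of 0] permutes_0[OF perm] by simp
  fix i assume "i \<le> n"
  note step[OF this]
  also have "int i - int z - m * int k = int i + (- int z - m * int k)" by simp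
  also have "[int i + (- int z - m * int k) = int i + 0] (mod (int n + 1))"
    by (rule cong_add[OF cong_refl cong_sym[OF 0]])
  finally have "[int (\<rho> i * k) = int i] (mod int (n + 1))" by (simp add: add.commute)
  then show "[\<rho> i * k = i] (mod (n + 1))" by (simp only: cong_int_iff)
qed

section \<open>Characterization of the toric avoiders\<close>

text \<open>Starting from the letter 0 at position 0, j jumps of length k reach the letter j, which
  therefore stands at position \<open>j * k\<close>.\<close>

lemma constant_jump_natural:
  assumes perm: "\<pi> permutes {1..n}" and const: "\<And>p. jump n \<pi> p = k"
  shows "\<pi> = natural_perm k n" "coprime k (n + 1)"
proof -
  have L: "[int (letter n \<pi> (j * k)) = int j] (mod (int n + 1))" for j
  proof (induction j)
    case 0
    then show ?case using permutes_0[OF perm] by (simp add: letter_def)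
  next
    case (Suc j)
    have "[int (letter n \<pi> (j * k + k)) = int (letter n \<pi> (j * k)) + 1] (mod (int n + 1))"
      using jump(2)[OF perm, of "j * k"] const by simp
    also have "[int (letter n \<pi> (j * k)) + 1 = int j + 1] (mod (int n + 1))"
      by (rule cong_add[OF Suc cong_refl])
    finally show ?case by (simp add: add.commute)
  qed
  have c: "[\<pi> i * k = i] (mod (n + 1))" if "i \<le> n" for i
    using L[of "\<pi> i"] cong_letters_iff[OF perm, of "\<pi> i * k" i] that by (simp add: letter_small)
  show "\<pi> = natural_perm k n" by (rule natural_perm_unique[OF perm c])
  show "coprime k (n + 1)"
  proof (cases "n = 0")
    case False
    \<comment> \<open>The letter at position 1 is an inverse of k modulo n + 1.\<close>
    then have "[k * \<pi> 1 = 1] (mod (n + 1))" using c[of 1] by (simp add: mult.commute)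
    then show ?thesis using coprime_iff_invertible_nat by auto
  qed simp
qed

lemma toric_avoiders_213_eq:
  assumes n: "n \<ge> 1"
  shows "toric_avoiders avoids_213 n =
    {natural_perm k n | k. 1 \<le> k \<and> k \<le> n \<and> coprime k (n + 1)}" (is "?A = ?B")
proof
  show "?A \<subseteq> ?B"
  proof
    fix \<pi> assume "\<pi> \<in> ?A"
    then have perm: "\<pi> permutes {1..n}"
      and all: "\<And>\<sigma>. \<sigma> permutes {1..n} \<Longrightarrow> torically_equivalent n \<pi> \<sigma> \<Longrightarrow> avoids_213 n \<sigma>"
      unfolding toric_avoiders_def by auto
    \<comment> \<open>The shift by 0 puts \<open>\<pi>\<close> into its own class, so
      \<open>\<pi>\<close> can serve as the common source in
      \<open>torically_equivalent\<close>.\<close>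
    have self: "\<pi> \<in> toric_class n \<pi>"
      using toric_add_0[OF perm] unfolding toric_class_def by (auto intro!: exI[of _ 0])
    have av: "avoids_213 n (toric_add n \<pi> m)" if "m \<in> {0..int n}" for m
      using that self perm
      by (intro all toric_add_permutes) (auto simp: torically_equivalent_def toric_class_def)
    have mono: "jump n \<pi> p \<le> jump n \<pi> q" if "p \<le> q" for p q
      using that jump_mono_step[OF perm n av] by (rule lift_Suc_mono_le[rotated])
    have const: "jump n \<pi> p = jump n \<pi> 0" for p
    proof -
      \<comment> \<open>The same word is read from position 0 and from \<open>(n + 1) * p\<close>,
        so the jumps there agree. Monotonicity squeezes the jump at p between them.\<close>
      have "letter n \<pi> ((n + 1) * p + i) = letter n \<pi> (0 + i)" for i
        by (simp add: letter_def del: mult_Suc)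
      from this this[of 0] have "jump n \<pi> ((n + 1) * p) = jump n \<pi> 0"
        unfolding jump_def by (simp only: add_0_right)
      then show ?thesis
        using mono[of 0 p] mono[of p "(n + 1) * p"] by simp
    qed
    show "\<pi> \<in> ?B"
      using constant_jump_natural[OF perm const] jump(1)[OF perm, of 0] jump_pos[OF perm n, of 0]
      by blast
  qed
next
  show "?B \<subseteq> ?A"
  proof
    fix \<pi> assume "\<pi> \<in> ?B"
    then obtain k where k: "\<pi> = natural_perm k n" "1 \<le> k" "k \<le> n" "coprime k (n + 1)" by blast
    have av: "avoids_213 n \<pi>" using natural_perm_avoids k by simp
    have "avoids_213 n \<sigma>" if equiv: "torically_equivalent n \<pi> \<sigma>" for \<sigma>
    proof -
      obtain \<rho> m m' where r: "\<rho> permutes {1..n}" "\<pi> = toric_add n \<rho> m" "\<sigma> = toric_add n \<rho> m'"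
        using equiv unfolding torically_equivalent_def toric_class_def by blast
      \<comment> \<open>Once the source is natural, all its translates coincide with it.\<close>
      have "\<rho> = natural_perm k n"
        using toric_add_eq_naturalD[OF r(1) k(4)] r(2) k(1) by metis
      then have "\<sigma> = \<pi>" using r(3) toric_add_natural[OF k(4)] k(1) by simp
      then show ?thesis using av by simp
    qed
    then show "\<pi> \<in> ?A"
      using natural_perm(1)[OF k(4)] av k(1) unfolding toric_avoiders_def by blast
  qed
qed

section \<open>Cardinality and group structure\<close>

text \<open>If the permutations for k and l agree, the letter 1 stands at both positions k and
  l.\<close>

lemma inj_on_natural_perm:
  assumes "n \<ge> 1"
  shows "inj_on (\<lambda>k. natural_perm k n) {k. 1 \<le> k \<and> k \<le> n \<and> coprime k (n + 1)}"
proof (rule inj_onI)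
  fix k l
  assume kl: "k \<in> {k. 1 \<le> k \<and> k \<le> n \<and> coprime k (n + 1)}"
    "l \<in> {k. 1 \<le> k \<and> k \<le> n \<and> coprime k (n + 1)}" "natural_perm k n = natural_perm l n"
  then have "natural_perm k n k = natural_perm k n l"
    using natural_perm_self[of k n] natural_perm_self[of l n] assms by simp
  then show "k = l" using inj_eq[OF permutes_inj[OF natural_perm(1), of k n]] kl by simp
qed

theorem theorem6p27:
  fixes n :: nat
  assumes "n \<ge> 1"
  shows "toric_avoiders avoids_213 n =
           {natural_perm k n | k. 1 \<le> k \<and> k \<le> n \<and> coprime k (n + 1)} \<and>
         card (toric_avoiders avoids_213 n) = totient (n + 1) \<and>
         subgroup (toric_avoiders avoids_213 n) (sym_group n) \<and>
         (\<exists>f. (\<forall>k. 1 \<le> k \<and> k \<le> n \<and> coprime k (n + 1) \<longrightarrow> f (natural_perm k n) = int k) \<and>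
              f \<in> hom (sym_group n\<lparr>carrier := toric_avoiders avoids_213 n\<rparr>)
                       (units_of (residue_ring (int (n + 1)))))"
proof (intro conjI)
  define K where "K = {k. 1 \<le> k \<and> k \<le> n \<and> coprime k (n + 1)}"
  have eq: "toric_avoiders avoids_213 n = (\<lambda>k. natural_perm k n) ` K"
    unfolding toric_avoiders_213_eq[OF assms] K_def by blast
  have inj: "inj_on (\<lambda>k. natural_perm k n) K"
    unfolding K_def by (rule inj_on_natural_perm[OF assms])
  have K_mod: "k mod (n + 1) \<in> K" if "coprime k (n + 1)" for k
    using coprime_mod_range[OF that assms] unfolding K_def by blast
  have comp: "natural_perm k n \<circ> natural_perm l n = natural_perm (k * l mod (n + 1)) n"
    "k * l mod (n + 1) \<in> K" if "k \<in> K" "l \<in> K" for k l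
    using that natural_perm_comp[of k n l] K_mod[of "k * l"] by (auto simp: K_def)
  show "toric_avoiders avoids_213 n = {natural_perm k n | k. 1 \<le> k \<and> k \<le> n \<and> coprime k (n + 1)}"
    by (rule toric_avoiders_213_eq[OF assms])
  \<comment> \<open>Totatives may range up to n + 1, but n + 1 is not coprime to itself as it
    exceeds 1.\<close>
  have "K = totatives (n + 1)"
    unfolding K_def totatives_def using assms
    by (auto simp: le_Suc_eq)
  then show "card (toric_avoiders avoids_213 n) = totient (n + 1)"
    unfolding eq card_image[OF inj] totient_def by simp
  show "subgroup (toric_avoiders avoids_213 n) (sym_group n)"
  proof (rule group.subgroupI[OF sym_group_is_group])
    show "toric_avoiders avoids_213 n \<subseteq> carrier (sym_group n)"
      unfolding eq K_def sym_group_def using natural_perm(1) by auto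
    have "1 \<in> K" using assms unfolding K_def by simp
    then show "toric_avoiders avoids_213 n \<noteq> {}" unfolding eq by blast
    show "p \<otimes>\<^bsub>sym_group n\<^esub> q \<in> toric_avoiders avoids_213 n"
      if "p \<in> toric_avoiders avoids_213 n" "q \<in> toric_avoiders avoids_213 n" for p q
      using that comp unfolding eq by (auto simp: sym_group_def)
    show "inv\<^bsub>sym_group n\<^esub> p \<in> toric_avoiders avoids_213 n"
      if p: "p \<in> toric_avoiders avoids_213 n" for p
    proof -
      obtain k where k: "p = natural_perm k n" "k \<in> K" using p unfolding eq by (rule imageE)
      then have "coprime k (n + 1)" unfolding K_def by simp
      \<comment> \<open>An inverse of k modulo n + 1, reduced to a residue in \<open>K\<close>,
        indexes the inverse permutation.\<close>
      then obtain l where l: "[k * l = 1] (mod (n + 1))"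
         using coprime_iff_invertible_nat by auto
      then have "[l * k = 1] (mod (n + 1))" by (simp add: mult.commute)
      then have "coprime l (n + 1)" using coprime_iff_invertible_nat by auto
      then have lK: "l mod (n + 1) \<in> K" by (rule K_mod)
      have "l mod (n + 1) * k mod (n + 1) = 1"
        using \<open>[l * k = 1] (mod (n + 1))\<close> assms unfolding mod_mult_left_eq cong_def by simp
      then have "natural_perm (l mod (n + 1)) n \<circ> p = id"
        using comp(1)[OF lK k(2)] k(1) natural_perm_one by simp
      moreover have "p \<in> carrier (sym_group n)" "natural_perm (l mod (n + 1)) n \<in> carrier (sym_group n)"
        using k lK natural_perm(1) unfolding K_def sym_group_def by auto
      ultimately have "inv\<^bsub>sym_group n\<^esub> p = natural_perm (l mod (n + 1)) n"
        by (intro group.inv_equality[OF sym_group_is_group]) (auto simp: sym_group_def)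
      then show ?thesis using lK unfolding eq by simp
    qed
  qed
  \<comment> \<open>Reads k off \<open>natural_perm k n\<close>; injectivity on \<open>K\<close>
    makes the value the intended one.\<close>
  define f where "f \<pi> = int (inv_into K (\<lambda>k. natural_perm k n) \<pi>)" for \<pi>
  have f: "f (natural_perm k n) = int k" if "k \<in> K" for k
    unfolding f_def using inv_into_f_f[OF inj that] by simp
  interpret residues "int (n + 1)" "residue_ring (int (n + 1))"
    using assms by unfold_locales auto
  have units: "int k \<in> Units (residue_ring (int (n + 1)))" if "k \<in> K" for k
  proof -
    have "coprime (int k) (int (n + 1))" using that unfolding K_def by (simp only: coprime_int_iff) simp
    then show ?thesis using that unfolding K_def res_units_eq by auto
  qed
  have "f \<in> hom (sym_group n\<lparr>carrier := toric_avoiders avoids_213 n\<rparr>)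
      (units_of (residue_ring (int (n + 1))))"
  proof (rule homI)
    fix p q assume "p \<in> carrier (sym_group n\<lparr>carrier := toric_avoiders avoids_213 n\<rparr>)"
      "q \<in> carrier (sym_group n\<lparr>carrier := toric_avoiders avoids_213 n\<rparr>)"
    then obtain k l where kl: "k \<in> K" "l \<in> K" "p = natural_perm k n" "q = natural_perm l n"
      unfolding eq by auto
    \<comment> \<open>Composition multiplies the indices modulo n + 1, which is the product in the
      residue ring.\<close>
    then have "f (p \<circ> q) = int (k * l mod (n + 1))" using comp f by simp
    then show "f (p \<otimes>\<^bsub>sym_group n\<lparr>carrier := toric_avoiders avoids_213 n\<rparr>\<^esub> q)
        = f p \<otimes>\<^bsub>units_of (residue_ring (int (n + 1)))\<^esub> f q"
      using kl f by (simp add: sym_group_def units_of_mult residue_ring_def zmod_int)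
  qed (use units f in \<open>auto simp: eq units_of_carrier\<close>)
  then show "\<exists>f. (\<forall>k. 1 \<le> k \<and> k \<le> n \<and> coprime k (n + 1) \<longrightarrow> f (natural_perm k n) = int k) \<and>
      f \<in> hom (sym_group n\<lparr>carrier := toric_avoiders avoids_213 n\<rparr>)
        (units_of (residue_ring (int (n + 1))))"
    using f unfolding K_def by blast
qed

end
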